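(* Let $(X,d)$ and $(Y,e)$ be metric spaces, $E\subseteq X$, $f:E\to Y$. Let $K,L\subseteq\mathbb N$ and $\alpha:K\to X$, $\beta:L\to Y$ with $\mathrm{rng}(\alpha)$ dense in $X$ and $\mathrm{rng}(\beta)$ dense in $Y$; let $r_0,r_1,\ldots$ be a computable sequence of positive rationals having $0$ as an accumulation point; let $\langle\cdot,\cdot\rangle:\mathbb N^2\to\mathbb N$ be a computable bijection, $I=\{\langle k,m\rangle\mid k\in K,m\in\mathbb N\}$, $J=\{\langle l,n\rangle\mid l\in L,n\in\mathbb N\}$, $U_{\langle k,m\rangle}=B_d(\alpha(k),r_m)$, $V_{\langle l,n\rangle}=B_e(\beta(l),r_n)$, $\mathcal U=\{U_i\}_{i\in I}$, $\mathcal V=\{V_j\}_{j\in J}$. Suppose $L$ is recursively enumerable and there exists a recursively enumerable subset $H$ of $K\times\mathbb N\times K\times\mathbb N\times K\times\mathbb N$ such that for all $k_1,k_2\in K$ and $m_1,m_2\in\mathbb N$, $$U_{\langle k_1,m_1\rangle}\cap U_{\langle k_2,m_2\rangle}=\bigcup\{U_{\langle k,m\rangle}\mid (k_1,m_1,k_2,m_2,k,m)\in H\}.$$ If $f$ is $(\mathcal U,\mathcal V)$-computable, then there exists a recursively enumerable topological $(\alpha,\beta)$-approximation system for $f$.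
   Context: $B_d(x,r)=\{\bar x\in X\mid d(x,\bar x)<r\}$, similarly $B_e$. A topological $(\alpha,\beta)$-approximation system for $f$ is a subset $S\subseteq K\times\mathbb N\times L\times\mathbb N$ such that for every $x\in E$ and every $(l,n)\in L\times\mathbb N$: $e(\beta(l),f(x))<r_n$ iff there exist $k,m$ with $(k,m,l,n)\in S$ and $d(\alpha(k),x)<r_m$. For $x\in X$ let $[x]_{\mathcal U}=\{i\in I\mid x\in U_i\}$, for $y\in Y$ let $[y]_{\mathcal V}=\{j\in J\mid y\in V_j\}$; $f$ is $(\mathcal U,\mathcal V)$-computable if there is an enumeration operator $F:\mathcal P(\mathbb N)\to\mathcal P(\mathbb N)$ with $[f(x)]_{\mathcal V}=F([x]_{\mathcal U})$ for all $x\in E$. *)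

theory Defs
  imports "HOL-Analysis.Analysis" "HOL-Library.Nat_Bijection"
begin

(* recursive_fun n f: the restriction of f to lists of length n is a total recursive function of
   n arguments, in the sense of Kleene (primitive recursion and minimization of regular functions).
   Values of f on lists of any other length are irrelevant, as the last rule makes explicit. *)
inductive recursive_fun :: "nat \<Rightarrow> (nat list \<Rightarrow> nat) \<Rightarrow> bool" where
  zero: "recursive_fun n (\<lambda>xs. 0)"
| succ: "recursive_fun 1 (\<lambda>xs. Suc (xs ! 0))"
| proj: "i < n \<Longrightarrow> recursive_fun n (\<lambda>xs. xs ! i)"
| comp: "recursive_fun (length hs) g \<Longrightarrow> (\<forall>h\<in>set hs. recursive_fun n h) \<Longrightarrow>
    recursive_fun n (\<lambda>xs. g (map (\<lambda>h. h xs) hs))"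
| prec: "recursive_fun n g \<Longrightarrow> recursive_fun (n + 2) h \<Longrightarrow>
    recursive_fun (n + 1) (\<lambda>xs. rec_nat (g (tl xs)) (\<lambda>y v. h (y # v # tl xs)) (hd xs))"
| minim: "recursive_fun (n + 1) g \<Longrightarrow> (\<forall>xs. length xs = n \<longrightarrow> (\<exists>y. g (y # xs) = 0)) \<Longrightarrow>
    recursive_fun n (\<lambda>xs. LEAST y. g (y # xs) = 0)"
| restrict: "recursive_fun n f \<Longrightarrow> (\<forall>xs. length xs = n \<longrightarrow> f xs = g xs) \<Longrightarrow> recursive_fun n g"

definition computable_fun :: "(nat \<Rightarrow> nat) \<Rightarrow> bool" where
  "computable_fun f \<longleftrightarrow> recursive_fun 1 (\<lambda>xs. f (xs ! 0))"

definition computable_fun2 :: "(nat \<Rightarrow> nat \<Rightarrow> nat) \<Rightarrow> bool" where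
  "computable_fun2 f \<longleftrightarrow> recursive_fun 2 (\<lambda>xs. f (xs ! 0) (xs ! 1))"

definition computable_rat_seq :: "(nat \<Rightarrow> rat) \<Rightarrow> bool" where
  "computable_rat_seq r \<longleftrightarrow>
    (\<exists>s a b. computable_fun s \<and> computable_fun a \<and> computable_fun b \<and>
      (\<forall>n. b n \<noteq> 0 \<and> r n = (- 1) ^ s n * (of_nat (a n) / of_nat (b n))))"

(* A p-ary relation on the naturals, given as a set of lists of length p, is recursively enumerable
   if it is empty or enumerated, coordinatewise, by total recursive functions. *)
definition re_rel :: "nat \<Rightarrow> nat list set \<Rightarrow> bool" where
  "re_rel p A \<longleftrightarrow>
    A = {} \<or>
    (\<exists>gs. length gs = p \<and> (\<forall>g\<in>set gs. computable_fun g) \<and> A = range (\<lambda>t. map (\<lambda>g. g t) gs))"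

definition re1 :: "nat set \<Rightarrow> bool" where
  "re1 A \<longleftrightarrow> re_rel 1 ((\<lambda>a. [a]) ` A)"

definition re2 :: "(nat \<times> nat) set \<Rightarrow> bool" where
  "re2 A \<longleftrightarrow> re_rel 2 ((\<lambda>(a, b). [a, b]) ` A)"

definition re4 :: "(nat \<times> nat \<times> nat \<times> nat) set \<Rightarrow> bool" where
  "re4 A \<longleftrightarrow> re_rel 4 ((\<lambda>(a, b, c, d). [a, b, c, d]) ` A)"

definition re6 :: "(nat \<times> nat \<times> nat \<times> nat \<times> nat \<times> nat) set \<Rightarrow> bool" where
  "re6 A \<longleftrightarrow> re_rel 6 ((\<lambda>(a, b, c, d, e, g). [a, b, c, d, e, g]) ` A)"

(* set_decode u is the finite set with canonical index u. *)
definition enumeration_operator :: "(nat set \<Rightarrow> nat set) \<Rightarrow> bool" where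
  "enumeration_operator F \<longleftrightarrow>
    (\<exists>W. re2 W \<and> (\<forall>A. F A = {j. \<exists>u. (u, j) \<in> W \<and> set_decode u \<subseteq> A}))"

definition index_set :: "nat set \<Rightarrow> (nat \<Rightarrow> 'a set) \<Rightarrow> 'a \<Rightarrow> nat set" where
  "index_set I U x = {i \<in> I. x \<in> U i}"

definition uv_computable ::
    "nat set \<Rightarrow> (nat \<Rightarrow> 'a set) \<Rightarrow> nat set \<Rightarrow> (nat \<Rightarrow> 'b set) \<Rightarrow> 'a set \<Rightarrow> ('a \<Rightarrow> 'b) \<Rightarrow> bool" where
  "uv_computable I U J V E f \<longleftrightarrow>
    (\<exists>F. enumeration_operator F \<and> (\<forall>x\<in>E. index_set J V (f x) = F (index_set I U x)))"

definition topological_approximation_system ::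
    "('a \<Rightarrow> 'a \<Rightarrow> real) \<Rightarrow> ('b \<Rightarrow> 'b \<Rightarrow> real) \<Rightarrow> (nat \<Rightarrow> rat) \<Rightarrow> nat set \<Rightarrow> (nat \<Rightarrow> 'a) \<Rightarrow>
      nat set \<Rightarrow> (nat \<Rightarrow> 'b) \<Rightarrow> 'a set \<Rightarrow> ('a \<Rightarrow> 'b) \<Rightarrow> (nat \<times> nat \<times> nat \<times> nat) set \<Rightarrow> bool" where
  "topological_approximation_system d e r K \<alpha> L \<beta> E f S \<longleftrightarrow>
    S \<subseteq> K \<times> UNIV \<times> L \<times> UNIV \<and>
    (\<forall>x\<in>E. \<forall>l\<in>L. \<forall>n.
      e (\<beta> l) (f x) < of_rat (r n) \<longleftrightarrow>
      (\<exists>k m. (k, m, l, n) \<in> S \<and> d (\<alpha> k) x < of_rat (r m)))"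

end

theory Submission
  imports Defs
begin

text \<open>Let W be the recursively enumerable set that defines the enumeration operator. Starting
  from an arbitrary basic ball and intersecting with the balls listed in a finite set D one after
  the other, H enumerates basic balls whose union is the intersection of the balls listed in D. The
  system S consists of all (k, m, l, n) such that the ball (k, m) is obtained in this way from a
  finite set whose canonical index u satisfies (u, \<langle>l, n\<rangle>) \<in> W. The set K is recursively
  enumerable because every ball contains its centre, so that K is the first projection of H.\<close>

section \<open>Closure properties of recursive functions\<close>

lemma recursive_fun_comp1:
  assumes "computable_fun F" "recursive_fun n f"
  shows "recursive_fun n (\<lambda>xs. F (f xs))"
  using recursive_fun.comp[of "[f]" "\<lambda>xs. F (xs ! 0)" n] assms
  by (simp add: computable_fun_def)

lemma recursive_fun_comp2:
  assumes "computable_fun2 F" "recursive_fun n f" "recursive_fun n g"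
  shows "recursive_fun n (\<lambda>xs. F (f xs) (g xs))"
  using recursive_fun.comp[of "[f, g]" "\<lambda>xs. F (xs ! 0) (xs ! 1)" n] assms
  by (simp add: computable_fun2_def numeral_2_eq_2)

lemma computable_comp1: "computable_fun F \<Longrightarrow> computable_fun f \<Longrightarrow> computable_fun (\<lambda>t. F (f t))"
  using recursive_fun_comp1[of F 1 "\<lambda>xs. f (xs ! 0)"] by (simp add: computable_fun_def)

lemma computable_comp2:
  "computable_fun2 F \<Longrightarrow> computable_fun f \<Longrightarrow> computable_fun g \<Longrightarrow> computable_fun (\<lambda>t. F (f t) (g t))"
  using recursive_fun_comp2[of F 1 "\<lambda>xs. f (xs ! 0)" "\<lambda>xs. g (xs ! 0)"]
  by (simp add: computable_fun_def)

lemma computable_id: "computable_fun (\<lambda>t. t)"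
  unfolding computable_fun_def by (rule recursive_fun.proj) simp

lemma computable_Suc_fun: "computable_fun Suc"
  unfolding computable_fun_def by (rule recursive_fun.succ)

lemmas computable_Suc = computable_comp1[OF computable_Suc_fun]

lemma computable_const: "computable_fun (\<lambda>t. c)"
proof (induction c)
  case 0
  show ?case unfolding computable_fun_def by (rule recursive_fun.zero)
qed (rule computable_Suc)

lemma computable_fun2_swap: "computable_fun2 F \<Longrightarrow> computable_fun2 (\<lambda>x y. F y x)"
  using recursive_fun_comp2[of F 2 "\<lambda>xs. xs ! 1" "\<lambda>xs. xs ! 0"]
  by (simp add: computable_fun2_def recursive_fun.proj)

lemma computable_rec_nat:
  assumes "computable_fun2 h"
  shows "computable_fun (rec_nat c h)"
proof -
  have g: "recursive_fun 0 (\<lambda>xs. c)"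
  proof (induction c)
    case (Suc c)
    then show ?case by (rule recursive_fun_comp1[OF computable_Suc_fun])
  qed (rule recursive_fun.zero)
  have h: "recursive_fun (0 + 2) (\<lambda>xs. h (xs ! 0) (xs ! 1))"
    using assms by (simp only: computable_fun2_def add_0)
  show ?thesis
    unfolding computable_fun_def
    by (rule recursive_fun.restrict[OF recursive_fun.prec[OF g h, unfolded add_0]])
       (auto simp: length_Suc_conv)
qed

lemma computable_fun2_rec_nat:
  assumes "computable_fun g" and "recursive_fun 3 (\<lambda>xs. h (xs ! 0) (xs ! 1) (xs ! 2))"
  shows "computable_fun2 (\<lambda>y x. rec_nat (g x) (\<lambda>y v. h y v x) y)"
proof -
  have g: "recursive_fun 1 (\<lambda>xs. g (xs ! 0))"
    using assms(1) by (simp add: computable_fun_def)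
  have h: "recursive_fun (1 + 2) (\<lambda>xs. h (xs ! 0) (xs ! 1) (xs ! 2))"
    using assms(2) by (simp only: numeral_Bit1 numeral_One one_add_one[symmetric] add.assoc)
  show ?thesis
    unfolding computable_fun2_def one_add_one[symmetric]
    by (rule recursive_fun.restrict[OF recursive_fun.prec[OF g h]])
       (auto simp: length_Suc_conv)
qed

section \<open>Arithmetic functions obtained by iteration\<close>

lemma computable_fun2_funpow: "computable_fun s \<Longrightarrow> computable_fun2 (\<lambda>p. s ^^ p)"
proof -
  assume s: "computable_fun s"
  have "computable_fun2 (\<lambda>p x. rec_nat x (\<lambda>_ v. s v) p)"
    by (rule computable_fun2_rec_nat[OF computable_id])
       (intro recursive_fun_comp1[OF s] recursive_fun.proj, simp)
  moreover have "rec_nat x (\<lambda>_ v. s v) p = (s ^^ p) x" for x p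
    by (induction p) auto
  ultimately show ?thesis by simp
qed

lemmas computable_funpow = computable_comp2[OF computable_fun2_funpow]

lemma computable_fun2_plus: "computable_fun2 (+)"
proof -
  have "(Suc ^^ p) x = p + x" for p x
    by (induction p) auto
  then show ?thesis
    using computable_fun2_funpow[OF computable_Suc_fun] by simp
qed

lemmas computable_plus = computable_comp2[OF computable_fun2_plus]

lemma computable_pred: "computable_fun (\<lambda>t. t - 1)"
proof -
  \<comment> \<open>Returning the counter as the new value makes the recursion yield
    \<open>y\<close> at \<open>Suc y\<close>, and the default 0 at 0.\<close>
  have "computable_fun2 (\<lambda>y v. y)"
    unfolding computable_fun2_def by (rule recursive_fun.proj) simp
  then have "computable_fun (rec_nat 0 (\<lambda>y v. y))"
    by (rule computable_rec_nat)
  moreover have "rec_nat 0 (\<lambda>y v. y) t = t - 1" for t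
    by (cases t) auto
  ultimately show ?thesis by (simp add: computable_fun_def)
qed

lemma computable_fun2_minus: "computable_fun2 (-)"
proof -
  have "((\<lambda>t. t - 1) ^^ p) x = x - p" for p x :: nat
    by (induction p) auto
  then show ?thesis
    using computable_fun2_swap[OF computable_fun2_funpow[OF computable_pred]] by simp
qed

lemmas computable_minus = computable_comp2[OF computable_fun2_minus]

lemma computable_fun2_times: "computable_fun2 (*)"
proof -
  have "computable_fun2 (\<lambda>y x. rec_nat 0 (\<lambda>_ v. v + x) y)"
    by (rule computable_fun2_rec_nat[OF computable_const])
       (intro recursive_fun_comp2[OF computable_fun2_plus] recursive_fun.proj, simp_all)
  moreover have "rec_nat 0 (\<lambda>_ v. v + x) y = y * x" for x y :: nat
    by (induction y) auto
  ultimately show ?thesis by simp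
qed

lemmas computable_times = computable_comp2[OF computable_fun2_times]

text \<open>Needed because adding \<open>2 ^ i\<close> to a canonical index inserts
  \<open>i\<close>.\<close>

lemma computable_power2_fun: "computable_fun (\<lambda>t. 2 ^ t)"
proof -
  have "computable_fun (\<lambda>t. ((\<lambda>x. x + x) ^^ t) 1)"
    by (intro computable_funpow computable_plus computable_id computable_const)
  moreover have "((\<lambda>x. x + x) ^^ t) 1 = (2::nat) ^ t" for t
    by (induction t) auto
  ultimately show ?thesis by simp
qed

lemmas computable_power2 = computable_comp1[OF computable_power2_fun]

lemma computable_triangle_fun: "computable_fun triangle"
proof -
  have "computable_fun2 (\<lambda>y v. v + Suc y)"
    unfolding computable_fun2_def
    by (intro recursive_fun_comp2[OF computable_fun2_plus]
          recursive_fun_comp1[OF computable_Suc_fun] recursive_fun.proj) simp_all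
  then have "computable_fun (rec_nat 0 (\<lambda>y v. v + Suc y))"
    by (rule computable_rec_nat)
  moreover have "rec_nat 0 (\<lambda>y v. v + Suc y) t = triangle t" for t
    by (induction t) auto
  ultimately show ?thesis by (simp add: computable_fun_def)
qed

lemmas computable_triangle = computable_comp1[OF computable_triangle_fun]

section \<open>Minimization and the inverses of the Cantor pairing\<close>

lemma computable_Least:
  assumes "computable_fun2 P" "\<And>x. \<exists>y. P y x = 0"
  shows "computable_fun (\<lambda>x. LEAST y. P y x = 0)"
proof -
  have P: "recursive_fun (1 + 1) (\<lambda>xs. P (xs ! 0) (xs ! 1))"
    using assms(1) unfolding computable_fun2_def one_add_one .
  show ?thesis
    unfolding computable_fun_def
    by (rule recursive_fun.restrict[OF recursive_fun.minim[OF P]]) (use assms(2) in auto)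
qed

lemma computable_prod_encode:
  "computable_fun f \<Longrightarrow> computable_fun g \<Longrightarrow> computable_fun (\<lambda>t. prod_encode (f t, g t))"
  unfolding prod_encode_def by (simp add: computable_plus computable_triangle)

lemma triangle_mono: "m \<le> n \<Longrightarrow> triangle m \<le> triangle n"
  by (rule lift_Suc_mono_le[of triangle]) auto

text \<open>Since \<open>prod_encode (m, n)\<close> is \<open>triangle (m + n) + m\<close>, the
  codes of pairs with sum \<open>s\<close> fill the interval from \<open>triangle s\<close> to just
  below \<open>triangle (Suc s)\<close>. So the sum is the least \<open>s\<close> such that the code
  is below \<open>triangle (Suc s)\<close>, expressed here by a vanishing truncated
  difference.\<close>

lemma Least_triangle_prod_encode:
  "(LEAST s. Suc (prod_encode (m, n)) - triangle (Suc s) = 0) = m + n"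
proof (rule Least_equality)
  fix y assume "Suc (prod_encode (m, n)) - triangle (Suc y) = 0"
  then have "\<not> triangle (Suc y) \<le> triangle (m + n)"
    by (simp add: prod_encode_def)
  then show "m + n \<le> y"
    using triangle_mono[of "Suc y" "m + n"] by (meson not_less_eq_eq)
qed (simp add: prod_encode_def)

lemma computable_prod_decode_funs:
  "computable_fun (\<lambda>t. fst (prod_decode t)) \<and> computable_fun (\<lambda>t. snd (prod_decode t))"
proof -
  \<comment> \<open>\<open>D z\<close> is the sum of the two components of the pair coded by
    \<open>z\<close>; both components follow from it by subtraction.\<close>
  define D where "D z = (LEAST s. Suc z - triangle (Suc s) = 0)" for z
  have D: "D (prod_encode (m, n)) = m + n" for m n
    unfolding D_def by (rule Least_triangle_prod_encode)
  have "computable_fun2 (\<lambda>s z. Suc z - triangle (Suc s))"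
    unfolding computable_fun2_def
    by (intro recursive_fun_comp2[OF computable_fun2_minus] recursive_fun.proj
          recursive_fun_comp1[OF computable_Suc_fun]
          recursive_fun_comp1[OF computable_triangle_fun]) simp_all
  moreover have "\<exists>s. Suc z - triangle (Suc s) = 0" for z
    by (rule exI[of _ z]) simp
  ultimately have cD: "computable_fun D"
    unfolding D_def by (rule computable_Least)
  have "z - triangle (D z) = fst (prod_decode z)"
    and "D z - (z - triangle (D z)) = snd (prod_decode z)" for z
  proof -
    obtain m n where "z = prod_encode (m, n)"
      by (metis prod_decode_inverse surj_pair)
    then show "z - triangle (D z) = fst (prod_decode z)"
      and "D z - (z - triangle (D z)) = snd (prod_decode z)"
      by (simp_all add: D) (simp_all add: prod_encode_def)
  qed
  moreover have "computable_fun (\<lambda>z. z - triangle (D z))"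
    by (intro computable_minus computable_triangle cD computable_id)
  moreover have "computable_fun (\<lambda>z. D z - (z - triangle (D z)))"
    by (intro computable_minus computable_triangle cD computable_id)
  ultimately show ?thesis by simp
qed

lemmas computable_prod_decode =
  computable_comp1[OF computable_prod_decode_funs[THEN conjunct1]]
  computable_comp1[OF computable_prod_decode_funs[THEN conjunct2]]

section \<open>Decidable predicates and definition by cases\<close>

definition decidable :: "(nat \<Rightarrow> bool) \<Rightarrow> bool" where
  "decidable P \<longleftrightarrow> computable_fun (\<lambda>t. of_bool (P t))"

lemma decidable_conj: "decidable P \<Longrightarrow> decidable Q \<Longrightarrow> decidable (\<lambda>t. P t \<and> Q t)"
  unfolding decidable_def of_bool_conj by (rule computable_times)

lemma decidable_less:
  assumes "computable_fun f" "computable_fun g"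
  shows "decidable (\<lambda>t. f t < g t)"
proof -
  \<comment> \<open>Subtracting twice from 1 turns every positive number into 1 and keeps 0.\<close>
  have "computable_fun (\<lambda>t. 1 - (1 - (g t - f t)))"
    by (intro computable_minus computable_const assms)
  moreover have "1 - (1 - (g t - f t)) = of_bool (f t < g t)" for t
    by simp
  ultimately show ?thesis by (simp add: decidable_def)
qed

lemma decidable_eq:
  assumes "computable_fun f" "computable_fun g"
  shows "decidable (\<lambda>t. f t = g t)"
proof -
  have "computable_fun (\<lambda>t. 1 - ((g t - f t) + (f t - g t)))"
    by (intro computable_minus computable_plus computable_const assms)
  moreover have "1 - ((g t - f t) + (f t - g t)) = of_bool (f t = g t)" for t
    by auto
  ultimately show ?thesis by (simp add: decidable_def)
qed

lemma computable_if:
  assumes "decidable P" "computable_fun f" "computable_fun g"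
  shows "computable_fun (\<lambda>t. if P t then f t else g t)"
proof -
  have "computable_fun (\<lambda>t. of_bool (P t) * f t + (1 - of_bool (P t)) * g t)"
    using assms unfolding decidable_def
    by (intro computable_plus computable_times computable_minus computable_const)
  moreover have "of_bool (P t) * f t + (1 - of_bool (P t)) * g t = (if P t then f t else g t)" for t
    by simp
  ultimately show ?thesis by simp
qed

lemmas computable_rules =
  computable_id computable_const computable_plus computable_power2
  computable_prod_encode computable_prod_decode computable_if
  decidable_conj decidable_less decidable_eq

section \<open>Recursively enumerable sets\<close>

text \<open>Nonemptiness rules out the first alternative of \<open>re_rel\<close>, and the coding by
  lists is injective, so it cancels. The versions for pairs and sextuples work in the same
  way.\<close>

lemma re1_nonempty:
  assumes "re1 A" "A \<noteq> {}"
  obtains g where "computable_fun g" "A = range g"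
proof -
  from assms obtain gs where gs: "length gs = 1" "\<forall>g\<in>set gs. computable_fun g"
    "(\<lambda>a. [a]) ` A = range (\<lambda>t. map (\<lambda>g. g t) gs)"
    unfolding re1_def re_rel_def by auto
  then obtain g where "gs = [g]" by (auto simp: length_Suc_conv)
  with gs have "computable_fun g" "(\<lambda>a. [a]) ` A = (\<lambda>a. [a]) ` range g"
    by (auto simp: image_image)
  moreover have "inj (\<lambda>a::nat. [a])" by (rule injI) simp
  ultimately show thesis by (intro that) (simp_all add: inj_image_eq_iff)
qed

lemma re2_nonempty:
  assumes "re2 A" "A \<noteq> {}"
  obtains g1 g2 where "computable_fun g1" "computable_fun g2" "A = range (\<lambda>t. (g1 t, g2 t))"
proof -
  let ?c = "\<lambda>(a::nat, b). [a, b]"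
  from assms obtain gs where gs: "length gs = 2" "\<forall>g\<in>set gs. computable_fun g"
    "?c ` A = range (\<lambda>t. map (\<lambda>g. g t) gs)"
    unfolding re2_def re_rel_def by auto
  then obtain g1 g2 where "gs = [g1, g2]" by (auto simp: length_Suc_conv numeral_eq_Suc)
  with gs have "computable_fun g1" "computable_fun g2" "?c ` A = ?c ` range (\<lambda>t. (g1 t, g2 t))"
    by (auto simp: image_image)
  moreover have "inj ?c" by (rule injI) auto
  ultimately show thesis by (intro that) (simp_all add: inj_image_eq_iff)
qed

lemma re6_nonempty:
  assumes "re6 A" "A \<noteq> {}"
  obtains g1 g2 g3 g4 g5 g6 where
    "computable_fun g1" "computable_fun g2" "computable_fun g3"
    "computable_fun g4" "computable_fun g5" "computable_fun g6"
    "A = range (\<lambda>t. (g1 t, g2 t, g3 t, g4 t, g5 t, g6 t))"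
proof -
  let ?c = "\<lambda>(a::nat, b, c, d, e, g). [a, b, c, d, e, g]"
  from assms obtain gs where gs: "length gs = 6" "\<forall>g\<in>set gs. computable_fun g"
    "?c ` A = range (\<lambda>t. map (\<lambda>g. g t) gs)"
    unfolding re6_def re_rel_def by auto
  then obtain g1 g2 g3 g4 g5 g6 where "gs = [g1, g2, g3, g4, g5, g6]"
    by (auto simp: length_Suc_conv numeral_eq_Suc)
  with gs have "computable_fun g1" "computable_fun g2" "computable_fun g3"
    "computable_fun g4" "computable_fun g5" "computable_fun g6"
    "?c ` A = ?c ` range (\<lambda>t. (g1 t, g2 t, g3 t, g4 t, g5 t, g6 t))"
    by (auto simp: image_image)
  moreover have "inj ?c" by (rule injI) auto
  ultimately show thesis by (intro that) (simp_all add: inj_image_eq_iff)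
qed

text \<open>The enumerating functions have to be total, so every index that fails \<open>P\<close>
  is redirected to one fixed index \<open>s\<close> that satisfies it. If there is no such
  \<open>s\<close>, the set is empty.\<close>

lemma re4_range_restrict:
  assumes "computable_fun a" "computable_fun b" "computable_fun c" "computable_fun d" "decidable P"
  shows "re4 {(a t, b t, c t, d t) | t. P t}"
proof (cases "\<exists>t. P t")
  case False
  then show ?thesis by (simp add: re4_def re_rel_def)
next
  case True
  then obtain s where s: "P s" by blast
  define p where "p g t = (if P t then g t else g s)" for g :: "nat \<Rightarrow> nat" and t
  have p: "computable_fun g \<Longrightarrow> computable_fun (p g)" for g
    unfolding p_def using assms(5) by (intro computable_if computable_const)
  have "(\<lambda>(a, b, c, d). [a, b, c, d]) ` {(a t, b t, c t, d t) | t. P t}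
      = range (\<lambda>t. map (\<lambda>g. g t) [p a, p b, p c, p d])"
    using s by (fastforce simp: p_def image_iff)
  with p assms(1-4) show ?thesis
    unfolding re4_def re_rel_def by (intro disjI2 exI[of _ "[p a, p b, p c, p d]"]) auto
qed

text \<open>The abstract form of the chains of balls below: a derivation is given by a starting
  element and a finite list of step parameters \<open>h\<close>, hence can be coded by a
  number.\<close>

inductive_set step_closure :: "nat set \<Rightarrow> (nat \<Rightarrow> nat \<Rightarrow> nat) \<Rightarrow> nat set" for A s where
  base: "a \<in> A \<Longrightarrow> a \<in> step_closure A s"
| step: "x \<in> step_closure A s \<Longrightarrow> s x h \<in> step_closure A s"

text \<open>The parameters of the successive steps are popped from the second component of the coded
  state, which serves as a stack; in the induction this stack has to be arbitrary.\<close>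

lemma step_closure_enumerable:
  assumes a: "computable_fun a" and s: "computable_fun (\<lambda>t. s (fst (prod_decode t)) (snd (prod_decode t)))"
  obtains g where "computable_fun g" "step_closure (range a) s = range g"
proof -
  define \<sigma> where "\<sigma> z = prod_encode (s (fst (prod_decode z)) (fst (prod_decode (snd (prod_decode z)))),
    snd (prod_decode (snd (prod_decode z))))" for z
  \<comment> \<open>\<open>t\<close> codes the number of steps, the index of the starting element
    and the initial stack. Every number is such a code, so \<open>g\<close> is total.\<close>
  define g where "g t = fst (prod_decode ((\<sigma> ^^ fst (prod_decode t))
    (prod_encode (a (fst (prod_decode (snd (prod_decode t)))), snd (prod_decode (snd (prod_decode t)))))))" for t
  have s2: "computable_fun (\<lambda>t. s (f t) (h t))" if "computable_fun f" "computable_fun h" for f h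
    using computable_comp1[OF s computable_prod_encode[OF that]] by simp
  have "computable_fun \<sigma>"
    unfolding \<sigma>_def by (intro s2 computable_rules)
  then have "computable_fun g"
    unfolding g_def by (intro computable_rules computable_funpow computable_comp1[OF a])
  moreover have "step_closure (range a) s = range g"
  proof (intro equalityI subsetI)
    fix x assume "x \<in> step_closure (range a) s"
    then have "\<exists>p i c. (\<sigma> ^^ p) (prod_encode (a i, c)) = prod_encode (x, c')" for c'
    proof (induction arbitrary: c')
      case (base b)
      then obtain i where "b = a i" by blast
      then have "(\<sigma> ^^ 0) (prod_encode (a i, c')) = prod_encode (b, c')" by simp
      then show ?case by blast
    next
      case (step x h)
      then obtain p i c where "(\<sigma> ^^ p) (prod_encode (a i, c)) = prod_encode (x, prod_encode (h, c'))"
        by blast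
      then have "(\<sigma> ^^ Suc p) (prod_encode (a i, c)) = prod_encode (s x h, c')"
        by (simp add: \<sigma>_def)
      then show ?case by blast
    qed
    then obtain p i c where "(\<sigma> ^^ p) (prod_encode (a i, c)) = prod_encode (x, 0)" by blast
    then have "g (prod_encode (p, prod_encode (i, c))) = x"
      by (simp add: g_def)
    then show "x \<in> range g" by blast
  next
    fix x assume "x \<in> range g"
    moreover have "fst (prod_decode ((\<sigma> ^^ p) (prod_encode (a i, c)))) \<in> step_closure (range a) s"
      for p i c
      by (induction p) (auto simp: \<sigma>_def intro: step_closure.intros)
    ultimately show "x \<in> step_closure (range a) s"
      by (auto simp: g_def)
  qed
  ultimately show thesis by (rule that)
qed

section \<open>Basic balls inside finite intersections\<close>

text \<open>The finite set with canonical index u consists of the indices of the balls met along the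
  chain. They are met in increasing order: then \<open>u < 2 ^ i\<close> says that \<open>i\<close> exceeds all members, and
  adding \<open>2 ^ i\<close> inserts \<open>i\<close>.\<close>

inductive inter_chain ::
    "(nat \<Rightarrow> nat \<Rightarrow> nat) \<Rightarrow> nat set \<Rightarrow> (nat \<times> nat \<times> nat \<times> nat \<times> nat \<times> nat) set \<Rightarrow>
      nat \<Rightarrow> nat \<Rightarrow> nat \<Rightarrow> bool" for pr K H where
  start: "k \<in> K \<Longrightarrow> inter_chain pr K H 0 k m"
| meet: "inter_chain pr K H u k m \<Longrightarrow> (k, m, k2, m2, k', m') \<in> H \<Longrightarrow> u < 2 ^ pr k2 m2 \<Longrightarrow>
    inter_chain pr K H (u + 2 ^ pr k2 m2) k' m'"

text \<open>Bit \<open>i\<close> of a number below \<open>2 ^ i\<close> is 0, so the addition only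
  sets this bit.\<close>

lemma set_decode_plus_power:
  assumes "u < 2 ^ i"
  shows "set_decode (u + 2 ^ i) = insert i (set_decode u)"
proof -
  have "i \<notin> set_decode u"
    using assms by (simp add: set_decode_def)
  then have "set_encode (insert i (set_decode u)) = u + 2 ^ i"
    by (simp add: set_encode_insert)
  then show ?thesis
    by (metis finite_insert finite_set_decode set_encode_inverse)
qed

text \<open>The extreme case is the set of all numbers below \<open>i\<close>, with the geometric
  sum \<open>2 ^ i - 1\<close> as its index. This secures the guard \<open>u < 2 ^ pr k2 m2\<close>
  of \<open>inter_chain\<close> when elements are added in increasing order.\<close>

lemma set_encode_less:
  assumes "finite A" "\<forall>a\<in>A. a < i"
  shows "set_encode A < 2 ^ i"
proof -
  have "set_encode A \<le> set_encode {..<i}"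
    unfolding set_encode_def using assms by (intro sum_mono2) auto
  also have "set_encode {..<i} < 2 ^ i"
    by (simp add: set_encode_def lessThan_atLeast0 sum_power2)
  finally show ?thesis .
qed

text \<open>Chains are an instance of \<open>step_closure\<close>: a state codes the current ball
  together with \<open>u\<close>, and a step parameter is the position of an element of
  \<open>H\<close> in its enumeration.\<close>

lemma inter_chain_enumerable:
  assumes pr: "computable_fun2 pr"
    and h: "computable_fun h1" "computable_fun h2" "computable_fun h3"
      "computable_fun h4" "computable_fun h5" "computable_fun h6"
    and H: "H = range (\<lambda>t. (h1 t, h2 t, h3 t, h4 t, h5 t, h6 t))"
    and K: "K = range h1"
  obtains ku kk km where "computable_fun ku" "computable_fun kk" "computable_fun km"
    "\<forall>u k m. inter_chain pr K H u k m \<longleftrightarrow> (\<exists>t. u = ku t \<and> k = kk t \<and> m = km t)"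
proof -
  let ?cd = "\<lambda>u k m. prod_encode (k, prod_encode (m, u))"
  let ?k = "\<lambda>x. fst (prod_decode x)"
  let ?m = "\<lambda>x. fst (prod_decode (snd (prod_decode x)))"
  let ?u = "\<lambda>x. snd (prod_decode (snd (prod_decode x)))"
  define a where "a t = ?cd 0 (h1 (fst (prod_decode t))) (snd (prod_decode t))" for t
  \<comment> \<open>The element of \<open>H\<close> has to begin with the current ball and to pass
    the guard. Otherwise the state is repeated, which keeps \<open>s\<close> total and adds nothing
    new.\<close>
  define s where "s x t = (if (h1 t = ?k x \<and> h2 t = ?m x) \<and> ?u x < 2 ^ pr (h3 t) (h4 t)
    then ?cd (?u x + 2 ^ pr (h3 t) (h4 t)) (h5 t) (h6 t) else x)" for x t
  have "computable_fun a"
    unfolding a_def by (intro computable_rules computable_comp1[OF h(1)])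
  moreover have "computable_fun (\<lambda>t. s (fst (prod_decode t)) (snd (prod_decode t)))"
    unfolding s_def
    by (intro computable_rules h[THEN computable_comp1] computable_comp2[OF pr])
  ultimately obtain g where g: "computable_fun g" "step_closure (range a) s = range g"
    by (rule step_closure_enumerable)
  have enum: "?cd u k m \<in> step_closure (range a) s" if "inter_chain pr K H u k m" for u k m
    using that
  proof induction
    case (start k m)
    then obtain t where "k = h1 t" using K by blast
    then have "?cd 0 k m = a (prod_encode (t, m))"
      by (simp add: a_def)
    then show ?case by (auto intro: step_closure.base)
  next
    case (meet u k m k2 m2 k' m')
    then obtain t where "k = h1 t" "m = h2 t" "k2 = h3 t" "m2 = h4 t" "k' = h5 t" "m' = h6 t"
      using H by blast
    then have "?cd (u + 2 ^ pr k2 m2) k' m' = s (?cd u k m) t"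
      using meet by (simp add: s_def)
    then show ?case using meet by (auto intro: step_closure.step)
  qed
  have chain: "inter_chain pr K H (?u x) (?k x) (?m x)" if "x \<in> step_closure (range a) s" for x
    using that
  proof induction
    case (base x)
    then obtain t where "x = a t" by blast
    then show ?case using K by (simp add: a_def inter_chain.start)
  next
    case (step x t)
    have "(h1 t, h2 t, h3 t, h4 t, h5 t, h6 t) \<in> H" using H by blast
    then show ?case
      using step inter_chain.meet[of pr K H "?u x" "?k x" "?m x" "h3 t" "h4 t" "h5 t" "h6 t"]
      by (auto simp: s_def)
  qed
  have "\<forall>u k m. inter_chain pr K H u k m \<longleftrightarrow>
    (\<exists>t. u = ?u (g t) \<and> k = ?k (g t) \<and> m = ?m (g t))"
  proof (intro allI iffI)
    fix u k m assume "inter_chain pr K H u k m"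
    then obtain t where "?cd u k m = g t"
      using enum unfolding g(2) by blast
    then show "\<exists>t. u = ?u (g t) \<and> k = ?k (g t) \<and> m = ?m (g t)"
      by (intro exI[of _ t]) (simp flip: \<open>?cd u k m = g t\<close>)
  next
    fix u k m assume "\<exists>t. u = ?u (g t) \<and> k = ?k (g t) \<and> m = ?m (g t)"
    then show "inter_chain pr K H u k m"
      using chain unfolding g(2) by auto
  qed
  moreover have "computable_fun (\<lambda>t. ?u (g t))" "computable_fun (\<lambda>t. ?k (g t))"
    "computable_fun (\<lambda>t. ?m (g t))"
    by (intro computable_rules g(1))+
  ultimately show thesis by (intro that)
qed

text \<open>By the inclusion from right to left in \<open>HU\<close>, each new ball lies in the
  previous one and in the ball just met, so the inclusions accumulate along the chain.\<close>

lemma inter_chain_sound: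
  assumes "inter_chain pr K H u k m" "H \<subseteq> K \<times> UNIV \<times> K \<times> UNIV \<times> K \<times> UNIV"
    and HU: "\<forall>k1\<in>K. \<forall>k2\<in>K. \<forall>m1 m2. U (pr k1 m1) \<inter> U (pr k2 m2) =
      \<Union>{U (pr k m) | k m. (k1, m1, k2, m2, k, m) \<in> H}"
  shows "k \<in> K \<and> set_decode u \<subseteq> {pr k m | k m. k \<in> K} \<and> (\<forall>i\<in>set_decode u. U (pr k m) \<subseteq> U i)"
  using assms(1)
proof induction
  case (start k m)
  then show ?case by simp
next
  case (meet u k m k2 m2 k' m')
  then have K: "k2 \<in> K" "k' \<in> K" using assms(2) by auto
  have "U (pr k' m') \<subseteq> U (pr k m) \<inter> U (pr k2 m2)"
    using HU meet K by blast
  then show ?case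
    using meet K unfolding set_decode_plus_power[OF meet.hyps(3)] by blast
qed

text \<open>By the inclusion from left to right in \<open>HU\<close>, each meet can be continued
  with a ball that still contains \<open>x\<close>. The induction adds the largest element last, as
  the guard of \<open>inter_chain\<close> demands; for empty \<open>A\<close> the ball
  \<open>(k0, m0)\<close> is taken.\<close>

lemma inter_chain_complete:
  assumes "finite A" "A \<subseteq> {pr k m | k m. k \<in> K}" "\<forall>i\<in>A. x \<in> U i"
    and "k0 \<in> K" "x \<in> U (pr k0 m0)"
    and H: "H \<subseteq> K \<times> UNIV \<times> K \<times> UNIV \<times> K \<times> UNIV"
    and HU: "\<forall>k1\<in>K. \<forall>k2\<in>K. \<forall>m1 m2. U (pr k1 m1) \<inter> U (pr k2 m2) =
      \<Union>{U (pr k m) | k m. (k1, m1, k2, m2, k, m) \<in> H}"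
  shows "\<exists>k m. k \<in> K \<and> inter_chain pr K H (set_encode A) k m \<and> x \<in> U (pr k m)"
  using assms(1-3)
proof (induction A rule: finite_linorder_max_induct)
  case empty
  then show ?case using assms(4,5) by (auto intro: inter_chain.start)
next
  case (insert i A)
  then obtain k m where km: "k \<in> K" "inter_chain pr K H (set_encode A) k m" "x \<in> U (pr k m)"
    by auto
  obtain k2 m2 where i: "i = pr k2 m2" "k2 \<in> K" using insert by auto
  have "x \<in> U (pr k m) \<inter> U (pr k2 m2)" using km insert i by auto
  then obtain k' m' where h: "(k, m, k2, m2, k', m') \<in> H" "x \<in> U (pr k' m')"
    using HU km(1) i(2) by blast
  have "inter_chain pr K H (set_encode A + 2 ^ pr k2 m2) k' m'"
    using km(2) h(1) set_encode_less[of A i] insert.hyps i(1) by (intro inter_chain.meet) auto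
  moreover have "set_encode (insert i A) = set_encode A + 2 ^ pr k2 m2"
    using insert.hyps i(1) by (subst set_encode_insert) auto
  moreover have "k' \<in> K" using h(1) H by auto
  ultimately show ?case using h(2) by auto
qed

section \<open>Enumerability and correctness of the system \<open>S\<close>\<close>

theorem theorem3p6:
  fixes X E :: "'a set" and d :: "'a \<Rightarrow> 'a \<Rightarrow> real"
    and Y :: "'b set" and e :: "'b \<Rightarrow> 'b \<Rightarrow> real"
    and f :: "'a \<Rightarrow> 'b"
    and K L :: "nat set" and \<alpha> :: "nat \<Rightarrow> 'a" and \<beta> :: "nat \<Rightarrow> 'b"
    and r :: "nat \<Rightarrow> rat" and pr :: "nat \<Rightarrow> nat \<Rightarrow> nat"
    and I J :: "nat set" and U :: "nat \<Rightarrow> 'a set" and V :: "nat \<Rightarrow> 'b set"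
  assumes "Metric_space X d" and "Metric_space Y e"
    and "E \<subseteq> X" and "f \<in> E \<rightarrow> Y"
    and "\<alpha> \<in> K \<rightarrow> X" and "\<beta> \<in> L \<rightarrow> Y"
    and "Metric_space.mtopology X d closure_of (\<alpha> ` K) = X"
    and "Metric_space.mtopology Y e closure_of (\<beta> ` L) = Y"
    and "computable_rat_seq r" and "\<And>n. r n > 0"
    and "(0::real) islimpt range (\<lambda>n. of_rat (r n))"
    and "computable_fun2 pr" and "bij (\<lambda>(a, b). pr a b)"
    and "I = {pr k m | k m. k \<in> K}" and "J = {pr l n | l n. l \<in> L}"
    and "\<And>k m. k \<in> K \<Longrightarrow> U (pr k m) = Metric_space.mball X d (\<alpha> k) (of_rat (r m))"
    and "\<And>l n. l \<in> L \<Longrightarrow> V (pr l n) = Metric_space.mball Y e (\<beta> l) (of_rat (r n))"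
    and "re1 L"
    and "\<exists>H. H \<subseteq> K \<times> UNIV \<times> K \<times> UNIV \<times> K \<times> UNIV \<and> re6 H \<and>
      (\<forall>k1\<in>K. \<forall>k2\<in>K. \<forall>m1 m2.
        U (pr k1 m1) \<inter> U (pr k2 m2) =
          \<Union>{U (pr k m) | k m. (k1, m1, k2, m2, k, m) \<in> H})"
    and "uv_computable I U J V E f"
  shows "\<exists>S. re4 S \<and> topological_approximation_system d e r K \<alpha> L \<beta> E f S"
proof -
  interpret X: Metric_space X d by fact
  interpret Y: Metric_space Y e by fact
  note \<alpha> = assms(5) and \<beta> = assms(6) and pos = assms(10) and I = assms(14) and J = assms(15)
    and U = assms(16) and V = assms(17)
  obtain H where HK: "H \<subseteq> K \<times> UNIV \<times> K \<times> UNIV \<times> K \<times> UNIV" and "re6 H"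
    and HU: "\<forall>k1\<in>K. \<forall>k2\<in>K. \<forall>m1 m2. U (pr k1 m1) \<inter> U (pr k2 m2) =
          \<Union>{U (pr k m) | k m. (k1, m1, k2, m2, k, m) \<in> H}"
    using assms(19) by blast
  obtain F where F: "enumeration_operator F" "\<forall>x\<in>E. index_set J V (f x) = F (index_set I U x)"
    using assms(20) unfolding uv_computable_def by blast
  then obtain W where "re2 W" and "\<forall>A. F A = {j. \<exists>u. (u, j) \<in> W \<and> set_decode u \<subseteq> A}"
    unfolding enumeration_operator_def by blast
  with F(2) have W: "\<forall>x\<in>E. index_set J V (f x) =
      {j. \<exists>u. (u, j) \<in> W \<and> set_decode u \<subseteq> index_set I U x}"
    by simp
  define S where "S = {(k, m, l, n). l \<in> L \<and> (\<exists>u. (u, pr l n) \<in> W \<and> inter_chain pr K H u k m)}"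
  have rpos: "(0::real) < of_rat (r n)" for n
    using pos by simp
  have inU: "x \<in> U (pr k m) \<longleftrightarrow> d (\<alpha> k) x < of_rat (r m)" if "k \<in> K" "x \<in> X" for k m x
    using that \<alpha> by (auto simp: U X.in_mball)
  have inV: "y \<in> V (pr l n) \<longleftrightarrow> e (\<beta> l) y < of_rat (r n)" if "l \<in> L" "y \<in> Y" for l n y
    using that \<beta> by (auto simp: V Y.in_mball)
  have KH: "K \<subseteq> fst ` H"
  proof
    fix k assume k: "k \<in> K"
    with \<alpha> have "\<alpha> k \<in> X" by auto
    \<comment> \<open>The ball is intersected with itself in order to apply \<open>HU\<close>; the
      radius index 0 is an arbitrary choice.\<close>
    with k have "\<alpha> k \<in> U (pr k 0) \<inter> U (pr k 0)"
      by (simp add: inU pos)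
    then have "\<alpha> k \<in> \<Union>{U (pr k' m') | k' m'. (k, 0, k, 0, k', m') \<in> H}"
      unfolding HU[rule_format, OF k k] .
    then obtain k' m' where "(k, 0, k, 0, k', m') \<in> H"
      by blast
    then show "k \<in> fst ` H" by force
  qed
  have "re4 S"
  proof (cases "S = {}")
    case True
    then show ?thesis by (simp add: re4_def re_rel_def)
  next
    case False
    \<comment> \<open>A single element of \<open>S\<close> shows that \<open>L\<close>,
      \<open>W\<close> and \<open>H\<close> are nonempty and hence enumerated by total functions;
      for \<open>H\<close> this goes through \<open>k \<in> K\<close> and \<open>KH\<close>.\<close>
    then obtain k m l n u where "l \<in> L" "(u, pr l n) \<in> W" "inter_chain pr K H u k m"
      by (auto simp: S_def)
    moreover from this have "k \<in> fst ` H"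
      using inter_chain_sound[OF _ HK HU] KH by blast
    ultimately have ne: "L \<noteq> {}" "W \<noteq> {}" "H \<noteq> {}"
      by auto
    obtain lf where lf: "computable_fun lf" "L = range lf"
      by (rule re1_nonempty[OF assms(18) ne(1)])
    obtain wu wj where w: "computable_fun wu" "computable_fun wj" "W = range (\<lambda>t. (wu t, wj t))"
      by (rule re2_nonempty[OF \<open>re2 W\<close> ne(2)])
    obtain h1 h2 h3 h4 h5 h6 where h: "computable_fun h1" "computable_fun h2" "computable_fun h3"
      "computable_fun h4" "computable_fun h5" "computable_fun h6"
      and H: "H = range (\<lambda>t. (h1 t, h2 t, h3 t, h4 t, h5 t, h6 t))"
      by (rule re6_nonempty[OF \<open>re6 H\<close> ne(3)])
    have "fst ` H = range h1" by (auto simp: H image_image)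
    moreover have "fst ` H \<subseteq> K" using HK by auto
    ultimately have K: "K = range h1" using KH by simp
    obtain ku kk km where c: "computable_fun ku" "computable_fun kk" "computable_fun km"
      and chain: "\<forall>u k m. inter_chain pr K H u k m \<longleftrightarrow> (\<exists>t. u = ku t \<and> k = kk t \<and> m = km t)"
      by (rule inter_chain_enumerable[OF assms(12) h H K])
    \<comment> \<open>\<open>t\<close> codes positions in the enumerations of the chains, of
      \<open>W\<close> and of \<open>L\<close>, followed by the radius index
      \<open>n\<close>.\<close>
    define p1 p2 p3 p4 where "p1 t = fst (prod_decode t)"
      and "p2 t = fst (prod_decode (snd (prod_decode t)))"
      and "p3 t = fst (prod_decode (snd (prod_decode (snd (prod_decode t)))))"
      and "p4 t = snd (prod_decode (snd (prod_decode (snd (prod_decode t)))))" for t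
    note p_def = p1_def p2_def p3_def p4_def
    \<comment> \<open>A chain and an element of \<open>W\<close> fit together if they share the
      canonical index and the second component is the index of the ball \<open>(l, n)\<close>; this
      is decidable.\<close>
    have "S = {(kk (p1 t), km (p1 t), lf (p3 t), p4 t) | t.
      wu (p2 t) = ku (p1 t) \<and> wj (p2 t) = pr (lf (p3 t)) (p4 t)}" (is "_ = ?S")
    proof
      show "S \<subseteq> ?S"
      proof
        fix z assume "z \<in> S"
        then obtain k m l n u where z: "z = (k, m, l, n)" "l \<in> L" "(u, pr l n) \<in> W"
          "inter_chain pr K H u k m" by (auto simp: S_def)
        obtain i where "l = lf i" using z(2) lf(2) by blast
        moreover obtain j where "wu j = u" "wj j = pr l n" using z(3) unfolding w(3) by auto
        moreover obtain q where "u = ku q" "k = kk q" "m = km q" 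
          using iffD1[OF chain[rule_format] z(4)] by blast
        ultimately show "z \<in> ?S"
          by (intro CollectI exI[of _ "prod_encode (q, prod_encode (j, prod_encode (i, n)))"])
             (simp add: p_def z(1))
      qed
      show "?S \<subseteq> S"
      proof
        fix z assume "z \<in> ?S"
        then obtain t where t: "z = (kk (p1 t), km (p1 t), lf (p3 t), p4 t)"
          "wu (p2 t) = ku (p1 t)" "wj (p2 t) = pr (lf (p3 t)) (p4 t)" by blast
        have "(wu (p2 t), wj (p2 t)) \<in> W" unfolding w(3) by (rule rangeI)
        moreover have "lf (p3 t) \<in> L" using lf(2) by blast
        moreover have "inter_chain pr K H (ku (p1 t)) (kk (p1 t)) (km (p1 t))"
          unfolding chain[rule_format] by blast
        ultimately show "z \<in> S" using t by (auto simp: S_def)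
      qed
    qed
    moreover have "re4 ?S"
      unfolding p_def
      by (intro re4_range_restrict computable_rules computable_comp2[OF assms(12)]
          computable_comp1[OF lf(1)] w(1,2)[THEN computable_comp1] c[THEN computable_comp1])
    ultimately show ?thesis by simp
  qed
  moreover have "topological_approximation_system d e r K \<alpha> L \<beta> E f S"
    unfolding topological_approximation_system_def
  proof (intro conjI ballI allI iffI)
    show "S \<subseteq> K \<times> UNIV \<times> L \<times> UNIV"
      using inter_chain_sound[OF _ HK HU] by (auto simp: S_def)
  next
    fix x l n assume x: "x \<in> E" and l: "l \<in> L" and less: "e (\<beta> l) (f x) < of_rat (r n)"
    have xX: "x \<in> X" and fx: "f x \<in> Y" using x assms(3,4) by auto
    \<comment> \<open>The inequality places \<open>f x\<close> in \<open>V (pr l n)\<close>, so the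
      operator obtains this index from a finite set of balls that all contain
      \<open>x\<close>.\<close>
    have "pr l n \<in> index_set J V (f x)"
      using l less fx inV J by (auto simp: index_set_def)
    then obtain u where u: "(u, pr l n) \<in> W" "set_decode u \<subseteq> index_set I U x"
      using W x by blast
    \<comment> \<open>A chain needs a first ball containing \<open>x\<close>, even when
      \<open>set_decode u\<close> is empty. By density some \<open>\<alpha> k0\<close> has distance
      less than \<open>r 0\<close> from \<open>x\<close>.\<close>
    have "x \<in> X.mtopology closure_of (\<alpha> ` K)" using assms(7) xX by simp
    then have "\<forall>\<epsilon>>0. \<exists>y\<in>\<alpha> ` K. y \<in> X.mball x \<epsilon>"
      by (simp add: X.metric_closure_of)
    from this[rule_format, OF rpos[of 0]] obtain k0
      where k0: "k0 \<in> K" "\<alpha> k0 \<in> X.mball x (of_rat (r 0))"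
      by blast
    then have "d (\<alpha> k0) x < of_rat (r 0)"
      by (simp add: X.commute)
    with k0(1) xX have "x \<in> U (pr k0 0)"
      by (simp add: inU)
    with k0(1) u(2) have "\<exists>k m. k \<in> K \<and> inter_chain pr K H (set_encode (set_decode u)) k m \<and> x \<in> U (pr k m)"
      by (intro inter_chain_complete[OF _ _ _ _ _ HK HU]) (auto simp: index_set_def I)
    then obtain k m where "k \<in> K" "inter_chain pr K H u k m" "x \<in> U (pr k m)"
      unfolding set_decode_inverse by blast
    moreover from this u(1) l have "(k, m, l, n) \<in> S"
      unfolding S_def by blast
    ultimately show "\<exists>k m. (k, m, l, n) \<in> S \<and> d (\<alpha> k) x < of_rat (r m)"
      using xX by (auto simp: inU)
  next
    fix x l n assume x: "x \<in> E" and l: "l \<in> L"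
      and "\<exists>k m. (k, m, l, n) \<in> S \<and> d (\<alpha> k) x < of_rat (r m)"
    then obtain k m u where u: "(u, pr l n) \<in> W" "inter_chain pr K H u k m"
      and less: "d (\<alpha> k) x < of_rat (r m)" by (auto simp: S_def)
    have xX: "x \<in> X" and fx: "f x \<in> Y" using x assms(3,4) by auto
    have k: "k \<in> K" and D: "set_decode u \<subseteq> I" "\<forall>i\<in>set_decode u. U (pr k m) \<subseteq> U i"
      using inter_chain_sound[OF u(2) HK HU] by (simp_all add: I)
    have "x \<in> U (pr k m)" using less xX k by (simp add: inU)
    \<comment> \<open>Soundness carries \<open>x\<close> from the ball \<open>(k, m)\<close> into
      all balls listed in \<open>u\<close>, so the operator outputs \<open>pr l n\<close>.\<close>
    with D have "set_decode u \<subseteq> index_set I U x"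
      by (auto simp: index_set_def)
    then have "pr l n \<in> index_set J V (f x)" using W x u(1) by blast
    then show "e (\<beta> l) (f x) < of_rat (r n)"
      using inV[OF l fx] by (simp add: index_set_def)
  qed
  ultimately show ?thesis by blast
qed

end
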